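(* Let $A, J \in \mathbb{R}^{n\times n}$ be invertible with $J = J^T$ or $J = -J^T$, and let $b \in \mathbb{R}^n$. Write $A = H + S$ with $H = \frac{1}{2}(A + JA^TJ^{-1}) \in \mathbb{J}$ and $S = \frac{1}{2}(A - JA^TJ^{-1}) \in \mathfrak{g}$, where $\mathbb{R}^{n\times n} = \mathfrak{g} \oplus \mathbb{J}$ is the decomposition into the eigenspaces for the eigenvalues $1$ and $-1$, respectively, of the involution $X \mapsto -JX^TJ^{-1}$. For $\alpha \in \mathbb{R}$ and $x^0 \in \mathbb{R}^n$, consider the $J$-HSS iteration $$ \begin{cases} (H + \alpha J^{-1})\, x^{k+\frac12} = (\alpha J^{-1} - S)\, x^{k} + b,\\ (S + \alpha J^{-1})\, x^{k+1} = (\alpha J^{-1} - H)\, x^{k+\frac12} + b, \end{cases} \qquad k = 0, 1, 2, \ldots $$ (i) If $J = J^T$ and the symmetric matrix $HJ$ is positive definite, then for all $\alpha > 0$ and all $x^0 \in \mathbb{R}^n$ the iteration is well-defined and the sequence $(x^k)_{k\ge 0}$ converges to the unique solution of $Ax = b$. (ii) If $J = -J^T$ and the symmetric matrix $SJ$ is positive definite, then for all $\alpha > 0$ and all $x^0 \in \mathbb{R}^n$ the iteration is well-defined and the sequence $(x^k)_{k\ge 0}$ converges to the unique solution of $Ax = b$. In this case, $n$ is necessarily even.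
   Context: All matrices are real. $\mathfrak{g} = \{X \in \mathbb{R}^{n\times n} : X = -JX^TJ^{-1}\}$ is a Lie algebra under $[X,Y] = XY - YX$ (the $J$-skew-symmetric matrices), and $\mathbb{J} = \{X \in \mathbb{R}^{n\times n} : X = JX^TJ^{-1}\}$ is a Jordan algebra under $X \bullet Y = \frac12(XY + YX)$ (the $J$-symmetric matrices). The iteration is "well-defined" if the two coefficient matrices $H + \alpha J^{-1}$ and $S + \alpha J^{-1}$ are invertible, so that each half-step has a unique solution. A symmetric matrix $M$ is positive definite if $x^TMx > 0$ for all nonzero $x \in \mathbb{R}^n$. *)

theory Defs
  imports "HOL-Analysis.Analysis"
begin

definition J_involution :: "real^'n^'n \<Rightarrow> real^'n^'n \<Rightarrow> real^'n^'n" where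
  "J_involution J X = - (J ** transpose X ** matrix_inv J)"

definition J_skew_matrices :: "real^'n^'n \<Rightarrow> (real^'n^'n) set" where
  "J_skew_matrices J = {X. X = - (J ** transpose X ** matrix_inv J)}"

definition J_sym_matrices :: "real^'n^'n \<Rightarrow> (real^'n^'n) set" where
  "J_sym_matrices J = {X. X = J ** transpose X ** matrix_inv J}"

definition eigenspace :: "('a::real_vector \<Rightarrow> 'a) \<Rightarrow> real \<Rightarrow> 'a set" where
  "eigenspace f c = {v. f v = c *\<^sub>R v}"

definition J_sym_part :: "real^'n^'n \<Rightarrow> real^'n^'n \<Rightarrow> real^'n^'n" where
  "J_sym_part J A = (1/2) *\<^sub>R (A + J ** transpose A ** matrix_inv J)"

definition J_skew_part :: "real^'n^'n \<Rightarrow> real^'n^'n \<Rightarrow> real^'n^'n" where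
  "J_skew_part J A = (1/2) *\<^sub>R (A - J ** transpose A ** matrix_inv J)"

definition symmetric_matrix :: "real^'n^'n \<Rightarrow> bool" where
  "symmetric_matrix M \<longleftrightarrow> transpose M = M"

definition positive_definite :: "real^'n^'n \<Rightarrow> bool" where
  "positive_definite M \<longleftrightarrow> symmetric_matrix M \<and> (\<forall>x. x \<noteq> 0 \<longrightarrow> x \<bullet> (M *v x) > 0)"

definition J_HSS_well_defined :: "real^'n^'n \<Rightarrow> real^'n^'n \<Rightarrow> real \<Rightarrow> bool" where
  "J_HSS_well_defined A J \<alpha> \<longleftrightarrow>
     invertible (J_sym_part J A + \<alpha> *\<^sub>R matrix_inv J) \<and>
     invertible (J_skew_part J A + \<alpha> *\<^sub>R matrix_inv J)"

text \<open>Here \<open>x k\<close> is the \<open>k\<close>-th iterate and \<open>y k\<close> is the intermediate iterate with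
  index \<open>k + 1/2\<close>. The half-steps are stated as linear systems, so sequences satisfying
  this relation need not exist or be unique unless the iteration is well-defined.\<close>

definition J_HSS_iteration ::
  "real^'n^'n \<Rightarrow> real^'n^'n \<Rightarrow> real^'n \<Rightarrow> real \<Rightarrow> real^'n \<Rightarrow>
   (nat \<Rightarrow> real^'n) \<Rightarrow> (nat \<Rightarrow> real^'n) \<Rightarrow> bool" where
  "J_HSS_iteration A J b \<alpha> x0 x y \<longleftrightarrow>
     x 0 = x0 \<and>
     (\<forall>k. (J_sym_part J A + \<alpha> *\<^sub>R matrix_inv J) *v y k =
            (\<alpha> *\<^sub>R matrix_inv J - J_skew_part J A) *v x k + b \<and>
          (J_skew_part J A + \<alpha> *\<^sub>R matrix_inv J) *v x (Suc k) =
            (\<alpha> *\<^sub>R matrix_inv J - J_sym_part J A) *v y k + b)"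

end

theory Submission
  imports Defs
begin

text \<open>
  Put \<open>u = J\<^sup>-\<^sup>1 x\<close>. The iteration becomes a Peaceman--Rachford splitting for
  \<open>A J = P + Q\<close> with \<open>P = H J\<close> and \<open>Q = S J\<close>; one of \<open>P\<close>, \<open>Q\<close> is skew-symmetric and the other
  is positive definite. Polarization gives
  \<open>|\<alpha>u + Pu|\<^sup>2 - |\<alpha>u - Pu|\<^sup>2 = 4\<alpha> u \<bullet> Pu\<close>, so for the errors \<open>u\<^sub>k\<close> and \<open>v\<^sub>k\<close> of the full
  and the half steps \<open>|\<alpha>u\<^sub>k + Qu\<^sub>k|\<^sup>2\<close> decreases by exactly
  \<open>4\<alpha>(u\<^sub>k \<bullet> Qu\<^sub>k + v\<^sub>k \<bullet> Pv\<^sub>k)\<close> in each step. These decrements therefore tend to zero,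
  and so does the error.
\<close>

section \<open>Matrix algebra: bilinearity, transposes and inverses\<close>

lemma matrix_minus_left: "(- A) ** B = - (A ** B)" for A :: "real^'m^'n" and B :: "real^'k^'m"
  by (simp add: matrix_matrix_mult_def vec_eq_iff sum_negf)

lemma matrix_minus_right: "A ** (- B) = - (A ** B)" for A :: "real^'m^'n" and B :: "real^'k^'m"
  by (simp add: matrix_matrix_mult_def vec_eq_iff sum_negf)

lemma matrix_scaleR_left: "(c *\<^sub>R A) ** B = c *\<^sub>R (A ** B)"
  for A :: "real^'m^'n" and B :: "real^'k^'m"
  by (simp add: matrix_matrix_mult_def vec_eq_iff sum_distrib_left mult.assoc)

lemma matrix_scaleR_right: "A ** (c *\<^sub>R B) = c *\<^sub>R (A ** B)"
  for A :: "real^'m^'n" and B :: "real^'k^'m"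
  by (simp add: matrix_matrix_mult_def vec_eq_iff sum_distrib_left mult.left_commute)

lemma matrix_add_rdistrib: "(A + B) ** C = A ** C + B ** C"
  for A B :: "real^'m^'n" and C :: "real^'k^'m"
  by (simp add: matrix_matrix_mult_def vec_eq_iff sum.distrib distrib_right)

lemma transpose_add: "transpose (A + B) = transpose A + transpose B" for A B :: "real^'m^'n"
  by (simp add: transpose_def vec_eq_iff)

lemma transpose_uminus: "transpose (- A) = - transpose A" for A :: "real^'m^'n"
  by (simp add: transpose_def vec_eq_iff)

lemma uminus_matrix_vector: "(- A) *v x = - (A *v x)" for A :: "real^'m^'n"
  by (simp add: matrix_vector_mult_def vec_eq_iff sum_negf)

lemma matrix_inv_cancel:
  fixes J :: "real^'n^'n"
  assumes "invertible J"
  shows "J ** matrix_inv J = mat 1" "matrix_inv J ** J = mat 1"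
  using someI_ex[OF assms[unfolded invertible_def]] unfolding matrix_inv_def by auto

lemma invertible_if_ker_trivial:
  fixes M :: "real^'n^'n"
  assumes "\<And>x. M *v x = 0 \<Longrightarrow> x = 0"
  shows "invertible M"
  using assms matrix_left_invertible_ker[of M] invertible_left_inverse by blast

text \<open>The sign \<open>s\<close> treats symmetric and skew-symmetric J at once. Transposing J
  J^-1 = I shows that \<open>s\<close> times the transposed inverse is a left inverse of J, hence
  equal to J^-1; multiplying by \<open>s\<close> again removes the sign.\<close>

lemma transpose_matrix_inv:
  fixes J :: "real^'n^'n"
  assumes "invertible J" "transpose J = s *\<^sub>R J" "s * s = 1"
  shows "transpose (matrix_inv J) = s *\<^sub>R matrix_inv J"
proof -
  have "transpose (matrix_inv J) ** transpose J = mat 1"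
    using matrix_inv_cancel(1)[OF assms(1)] by (metis matrix_transpose_mul transpose_mat)
  then have "s *\<^sub>R transpose (matrix_inv J) ** J = mat 1"
    by (simp add: assms(2) matrix_scaleR_left matrix_scaleR_right)
  then have "s *\<^sub>R transpose (matrix_inv J) = matrix_inv J"
    using matrix_inv_cancel(1)[OF assms(1)]
    by (metis matrix_mul_assoc matrix_mul_lid matrix_mul_rid)
  then show ?thesis
    by (metis assms(3) scaleR_one scaleR_scaleR)
qed

section \<open>The involution and its eigenspace decomposition\<close>

lemma J_involution_involutive:
  fixes J :: "real^'n^'n"
  assumes "invertible J" "transpose J = s *\<^sub>R J" "s * s = 1"
  shows "J_involution J (J_involution J X) = X"
proof -
  let ?K = "matrix_inv J"
  \<comment> \<open>The outer application transposes the inner one, so J and its inverse each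
    contribute a factor \<open>s\<close>, while the two minus signs cancel.\<close>
  have "J_involution J (J_involution J X) = (s * s) *\<^sub>R (J ** (?K ** (X ** J)) ** ?K)"
    by (simp add: J_involution_def transpose_uminus matrix_transpose_mul
        transpose_matrix_inv[OF assms] assms(2) matrix_minus_left matrix_minus_right
        matrix_scaleR_left matrix_scaleR_right)
  also have "\<dots> = (J ** ?K) ** X ** (J ** ?K)"
    by (simp add: assms(3) matrix_mul_assoc)
  finally show ?thesis
    by (simp add: matrix_inv_cancel[OF assms(1)])
qed

lemma linear_J_involution: "linear (J_involution J)"
  by (rule linearI)
    (simp_all add: J_involution_def transpose_add transpose_scalar matrix_add_ldistrib
      matrix_add_rdistrib matrix_scaleR_left matrix_scaleR_right)

lemma J_skew_matrices_eq_eigenspace: "J_skew_matrices J = eigenspace (J_involution J) 1"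
  by (auto simp: J_skew_matrices_def eigenspace_def J_involution_def)

lemma J_sym_matrices_eq_eigenspace: "J_sym_matrices J = eigenspace (J_involution J) (-1)"
  by (auto simp: J_sym_matrices_def eigenspace_def J_involution_def)

lemma subspace_eigenspace:
  assumes "linear f"
  shows "subspace (eigenspace f c)"
  by (auto simp: subspace_def eigenspace_def linear_0[OF assms] linear_add[OF assms]
      linear_scale[OF assms] scaleR_add_right)

text \<open>Exhibits H as a spectral projection of the involution, as the next lemma does for S;
  membership and uniqueness then follow from linearity and involutivity alone.\<close>

lemma J_sym_part_eq: "J_sym_part J A = (1/2) *\<^sub>R (A - J_involution J A)"
  by (simp add: J_sym_part_def J_involution_def)

lemma J_skew_part_eq: "J_skew_part J A = (1/2) *\<^sub>R (A + J_involution J A)"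
  by (simp add: J_skew_part_def J_involution_def)

lemma J_parts_add: "A = J_sym_part J A + J_skew_part J A"
  by (simp add: J_sym_part_eq J_skew_part_eq flip: scaleR_add_right scaleR_2)

lemma J_parts_mem:
  fixes J :: "real^'n^'n"
  assumes "invertible J" "transpose J = s *\<^sub>R J" "s * s = 1"
  shows "J_sym_part J A \<in> J_sym_matrices J" "J_skew_part J A \<in> J_skew_matrices J"
  unfolding J_skew_matrices_eq_eigenspace J_sym_matrices_eq_eigenspace
  by (simp_all add: J_sym_part_eq J_skew_part_eq eigenspace_def
      linear_scale[OF linear_J_involution] linear_add[OF linear_J_involution]
      linear_diff[OF linear_J_involution] J_involution_involutive[OF assms]
      add.commute flip: scaleR_minus_right)

lemma J_decomposition_unique:
  fixes J :: "real^'n^'n"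
  assumes "invertible J" "transpose J = s *\<^sub>R J" "s * s = 1"
  shows "\<exists>!(Y, Z). Y \<in> J_skew_matrices J \<and> Z \<in> J_sym_matrices J \<and> X = Y + Z"
proof (rule ex1I[of _ "(J_skew_part J X, J_sym_part J X)"])
  show "case (J_skew_part J X, J_sym_part J X) of
      (Y, Z) \<Rightarrow> Y \<in> J_skew_matrices J \<and> Z \<in> J_sym_matrices J \<and> X = Y + Z"
    using J_parts_mem[OF assms] J_parts_add[of X J] by (simp add: add.commute)
next
  fix p
  assume p: "case p of (Y, Z) \<Rightarrow> Y \<in> J_skew_matrices J \<and> Z \<in> J_sym_matrices J \<and> X = Y + Z"
  obtain Y Z where YZ: "p = (Y, Z)" by (cases p)
  with p have "J_involution J Y = Y" "J_involution J Z = - Z" and X: "X = Y + Z"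
    unfolding J_skew_matrices_eq_eigenspace J_sym_matrices_eq_eigenspace eigenspace_def by auto
  \<comment> \<open>Half the sum and half the difference of X = Y + Z and its image Y - Z recover Y
    and Z, so both are determined by X.\<close>
  then have "J_involution J X = Y - Z"
    by (simp add: linear_add[OF linear_J_involution])
  then show "p = (J_skew_part J X, J_sym_part J X)"
    by (simp add: YZ J_sym_part_eq J_skew_part_eq X flip: scaleR_2)
qed

section \<open>Symmetry types of H J and S J\<close>

lemma transpose_J_sym_mult:
  fixes J :: "real^'n^'n"
  assumes "invertible J" "transpose J = s *\<^sub>R J" "X \<in> J_sym_matrices J"
  shows "transpose (X ** J) = s *\<^sub>R (X ** J)"
proof -
  \<comment> \<open>Right multiplication by J clears the inverse and leaves X J = J X^T, whose
    transpose is X J^T = s X J.\<close>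
  have "X ** J = J ** transpose X ** (matrix_inv J ** J)"
    using assms(3) by (metis (mono_tags, lifting) J_sym_matrices_def matrix_mul_assoc mem_Collect_eq)
  then have "X ** J = J ** transpose X"
    by (simp add: matrix_inv_cancel[OF assms(1)])
  then show ?thesis
    by (simp add: matrix_transpose_mul transpose_uminus assms(2) matrix_scaleR_left matrix_scaleR_right)
qed

text \<open>The computation for J-symmetric matrices with one more sign. Hence for J symmetric, H J
  is symmetric and S J skew; for J skew the roles are exchanged.\<close>

lemma transpose_J_skew_mult:
  fixes J :: "real^'n^'n"
  assumes "invertible J" "transpose J = s *\<^sub>R J" "X \<in> J_skew_matrices J"
  shows "transpose (X ** J) = (- s) *\<^sub>R (X ** J)"
proof -
  have "X = - (J ** transpose X ** matrix_inv J)"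
    using assms(3) by (simp add: J_skew_matrices_def)
  then have "X ** J = - (J ** transpose X ** (matrix_inv J ** J))"
    by (metis matrix_minus_left matrix_mul_assoc)
  then have "X ** J = - (J ** transpose X)"
    by (simp add: matrix_inv_cancel[OF assms(1)])
  then show ?thesis
    by (simp add: matrix_transpose_mul transpose_uminus assms(2) matrix_scaleR_left matrix_scaleR_right)
qed

section \<open>Quadratic forms and convergence of the abstract splitting\<close>

lemma skew_quadratic_form_zero:
  fixes M :: "real^'n^'n"
  assumes "transpose M = - M"
  shows "x \<bullet> (M *v x) = 0"
proof -
  have "x \<bullet> (M *v x) = (transpose M *v x) \<bullet> x"
    by (simp add: dot_lmul_matrix)
  also have "\<dots> = - (x \<bullet> (M *v x))"
    by (simp add: assms uminus_matrix_vector inner_commute)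
  finally show ?thesis by simp
qed

text \<open>By compactness the form attains its minimum over the unit sphere. This minimum is
  positive and serves as \<open>c\<close>; homogeneity of degree two extends the bound to all
  vectors.\<close>

lemma positive_quadratic_form_coercive:
  fixes M :: "real^'n^'n"
  assumes "\<And>x. x \<noteq> 0 \<Longrightarrow> x \<bullet> (M *v x) > 0"
  obtains c where "c > 0" "\<And>x. c * (norm x)\<^sup>2 \<le> x \<bullet> (M *v x)"
proof -
  let ?f = "\<lambda>x::real^'n. x \<bullet> (M *v x)"
  have "sphere (0::real^'n) 1 \<noteq> {}"
    by simp
  moreover have "continuous_on (sphere 0 1) ?f"
    by (intro continuous_intros matrix_vector_mult_linear_continuous_on)
  ultimately obtain z where z: "norm z = 1" "\<And>y. norm y = 1 \<Longrightarrow> ?f z \<le> ?f y"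
    using continuous_attains_inf[OF compact_sphere, of 0 1 ?f] by auto
  have "?f z * (norm x)\<^sup>2 \<le> ?f x" for x
  proof (cases "x = 0")
    case False
    have "?f z \<le> ?f ((1 / norm x) *\<^sub>R x)"
      by (rule z(2)) (simp add: False)
    also have "\<dots> = ?f x / (norm x)\<^sup>2"
      by (simp add: matrix_vector_mult_scaleR power2_eq_square)
    finally show ?thesis
      using False by (simp add: field_simps)
  qed simp
  moreover have "?f z > 0"
    using z(1) by (intro assms) auto
  ultimately show thesis using that by blast
qed

text \<open>Coercivity squeezes the squared norm between 0 and the form divided by
  \<open>c\<close>.\<close>

lemma tendsto_0_if_quadratic_form_tendsto_0:
  fixes M :: "real^'n^'n" and u :: "nat \<Rightarrow> real^'n"
  assumes "\<And>x. x \<noteq> 0 \<Longrightarrow> x \<bullet> (M *v x) > 0"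
    and "(\<lambda>k. u k \<bullet> (M *v u k)) \<longlonglongrightarrow> 0"
  shows "u \<longlonglongrightarrow> 0"
proof -
  obtain c where c: "c > 0" "\<And>x. c * (norm x)\<^sup>2 \<le> x \<bullet> (M *v x)"
    using positive_quadratic_form_coercive[OF assms(1)] by blast
  have lim: "(\<lambda>k. (u k \<bullet> (M *v u k)) / c) \<longlonglongrightarrow> 0"
    using tendsto_divide[OF assms(2) tendsto_const[of c]] c(1) by simp
  have "(\<lambda>k. (norm (u k))\<^sup>2) \<longlonglongrightarrow> 0"
    by (rule tendsto_sandwich[OF _ _ tendsto_const lim]) (use c in \<open>auto simp: field_simps\<close>)
  then have "(\<lambda>k. sqrt ((norm (u k))\<^sup>2)) \<longlonglongrightarrow> sqrt 0"
    by (rule tendsto_real_sqrt)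
  then show ?thesis
    by (simp add: tendsto_norm_zero_iff)
qed

text \<open>Only nonnegativity is asked of both forms and strict positivity of one of them, so that
  the lemma serves whichever of H J and S J is skew. Strictness for Q controls \<open>u\<close>
  directly; strictness for P controls \<open>v\<close>, and the half step carries this over to
  \<open>u\<close>.\<close>

lemma splitting_errors_tendsto_0:
  fixes P Q :: "real^'n^'n" and u v :: "nat \<Rightarrow> real^'n"
  assumes P: "\<And>x. 0 \<le> x \<bullet> (P *v x)" and Q: "\<And>x. 0 \<le> x \<bullet> (Q *v x)" and "\<alpha> > 0"
    and strict: "(\<forall>x. x \<noteq> 0 \<longrightarrow> x \<bullet> (P *v x) > 0) \<or> (\<forall>x. x \<noteq> 0 \<longrightarrow> x \<bullet> (Q *v x) > 0)"
    and uv: "\<And>k. P *v v k + \<alpha> *\<^sub>R v k = \<alpha> *\<^sub>R u k - Q *v u k"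
    and vu: "\<And>k. Q *v u (Suc k) + \<alpha> *\<^sub>R u (Suc k) = \<alpha> *\<^sub>R v k - P *v v k"
  shows "u \<longlonglongrightarrow> 0"
proof -
  define w where "w k = (norm (Q *v u k + \<alpha> *\<^sub>R u k))\<^sup>2" for k
  define d where "d k = u k \<bullet> (Q *v u k) + v k \<bullet> (P *v v k)" for k
  \<comment> \<open>Both squares have the same pure terms; only the cross term 2 \<alpha> (x . Mx)
    changes sign.\<close>
  have polar: "(norm (\<alpha> *\<^sub>R x - M *v x))\<^sup>2 = (norm (M *v x + \<alpha> *\<^sub>R x))\<^sup>2 - 4 * \<alpha> * (x \<bullet> (M *v x))"
    for M :: "real^'n^'n" and x
    unfolding power2_norm_eq_inner by (simp add: inner_simps inner_commute)
  have step: "w (Suc k) = w k - 4 * \<alpha> * d k" for k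
  proof -
    \<comment> \<open>The polarization identity is applied twice: to P after the full step
      \<open>vu\<close>, then to Q after the half step \<open>uv\<close>.\<close>
    have "w (Suc k) = (norm (P *v v k + \<alpha> *\<^sub>R v k))\<^sup>2 - 4 * \<alpha> * (v k \<bullet> (P *v v k))"
      by (simp add: w_def vu polar)
    also have "\<dots> = w k - 4 * \<alpha> * d k"
      by (simp add: uv polar w_def d_def algebra_simps)
    finally show ?thesis .
  qed
  have d_nonneg: "0 \<le> d k" for k
    using P Q by (simp add: d_def)
  have "decseq w"
    using d_nonneg \<open>\<alpha> > 0\<close> by (simp add: decseq_Suc_iff step)
  then obtain l where l: "w \<longlonglongrightarrow> l"
    using decseq_convergent[of w 0] by (auto simp: w_def)
  \<comment> \<open>Being decreasing and bounded below by 0, \<open>w\<close> converges, so its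
    consecutive differences vanish in the limit; divided by 4 \<alpha> they are exactly
    \<open>d\<close>.\<close>
  have "(\<lambda>k. (w k - w (Suc k)) / (4 * \<alpha>)) \<longlonglongrightarrow> (l - l) / (4 * \<alpha>)"
    using \<open>\<alpha> > 0\<close> by (intro tendsto_intros l LIMSEQ_Suc) auto
  then have d: "d \<longlonglongrightarrow> 0"
    using \<open>\<alpha> > 0\<close> by (simp add: step)
  have Qu: "(\<lambda>k. u k \<bullet> (Q *v u k)) \<longlonglongrightarrow> 0"
    by (rule tendsto_sandwich[OF _ _ tendsto_const d]) (simp_all add: P Q d_def)
  have Pv: "(\<lambda>k. v k \<bullet> (P *v v k)) \<longlonglongrightarrow> 0"
    by (rule tendsto_sandwich[OF _ _ tendsto_const d]) (simp_all add: P Q d_def)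
  from strict show ?thesis
  proof
    assume "\<forall>x. x \<noteq> 0 \<longrightarrow> x \<bullet> (Q *v x) > 0"
    then show ?thesis
      using tendsto_0_if_quadratic_form_tendsto_0[OF _ Qu] by blast
  next
    assume "\<forall>x. x \<noteq> 0 \<longrightarrow> x \<bullet> (P *v x) > 0"
    then have v: "v \<longlonglongrightarrow> 0"
      using tendsto_0_if_quadratic_form_tendsto_0[OF _ Pv] by blast
    \<comment> \<open>By \<open>uv\<close> the vector whose norm is taken equals \<alpha> u - Q u,
      so the latter tends to 0. Adding 4 \<alpha> (u . Qu), which also tends to 0, turns its squared
      norm into \<open>w\<close> by \<open>polar\<close>.\<close>
    have "(\<lambda>k. (norm (P *v v k + \<alpha> *\<^sub>R v k))\<^sup>2) \<longlonglongrightarrow> (norm (P *v 0 + \<alpha> *\<^sub>R (0::real^'n)))\<^sup>2"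
      by (intro tendsto_intros v bounded_linear.tendsto[OF matrix_vector_mul_bounded_linear])
    then have "(\<lambda>k. (norm (\<alpha> *\<^sub>R u k - Q *v u k))\<^sup>2 + 4 * \<alpha> * (u k \<bullet> (Q *v u k))) \<longlonglongrightarrow> 0 + 4 * \<alpha> * 0"
      by (intro tendsto_intros Qu) (simp add: uv)
    then have w: "w \<longlonglongrightarrow> 0"
      by (simp add: polar w_def[abs_def])
    \<comment> \<open>The cross term of the expanded square is nonnegative, so \<open>w\<close>
      dominates the squared norm of \<alpha> u.\<close>
    have bound: "(norm (\<alpha> *\<^sub>R x))\<^sup>2 \<le> (norm (Q *v x + \<alpha> *\<^sub>R x))\<^sup>2" for x
    proof -
      have "(norm (Q *v x + \<alpha> *\<^sub>R x))\<^sup>2 =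
          (norm (Q *v x))\<^sup>2 + (norm (\<alpha> *\<^sub>R x))\<^sup>2 + 2 * \<alpha> * (x \<bullet> (Q *v x))"
        unfolding power2_norm_eq_inner by (simp add: inner_simps inner_commute)
      then show ?thesis
        using Q[of x] \<open>\<alpha> > 0\<close> by simp
    qed
    have "(\<lambda>k. (norm (\<alpha> *\<^sub>R u k))\<^sup>2) \<longlonglongrightarrow> 0"
      by (rule tendsto_sandwich[OF _ _ tendsto_const w]) (simp_all only: w_def bound zero_le_power2 eventually_True)
    then have "(\<lambda>k. sqrt ((norm (\<alpha> *\<^sub>R u k))\<^sup>2) / \<alpha>) \<longlonglongrightarrow> sqrt 0 / \<alpha>"
      using \<open>\<alpha> > 0\<close> by (intro tendsto_intros) auto
    then show ?thesis
      using \<open>\<alpha> > 0\<close> by (simp add: tendsto_norm_zero_iff)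
  qed
qed

section \<open>Solvability and convergence of the J-HSS iteration\<close>

lemma invertible_add_scaled_matrix_inv:
  fixes J M :: "real^'n^'n"
  assumes "invertible J" "\<alpha> > 0" "\<And>x. 0 \<le> x \<bullet> ((M ** J) *v x)"
  shows "invertible (M + \<alpha> *\<^sub>R matrix_inv J)"
proof (rule invertible_if_ker_trivial)
  fix x assume x: "(M + \<alpha> *\<^sub>R matrix_inv J) *v x = 0"
  define u where "u = matrix_inv J *v x"
  have xu: "x = J *v u"
    by (simp add: u_def matrix_vector_mul_assoc matrix_inv_cancel[OF assms(1)])
  \<comment> \<open>In the variable u = J^-1 x the kernel equation reads (M J + \<alpha> I) u = 0.
    Pairing it with u leaves two nonnegative terms with sum 0, which forces u = 0.\<close>
  have "(M ** J) *v u + \<alpha> *\<^sub>R u = 0"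
    using x by (simp add: xu matrix_vector_mult_add_rdistrib matrix_vector_mul_assoc matrix_add_rdistrib
        matrix_scaleR_left matrix_inv_cancel[OF assms(1)] flip: scaleR_matrix_vector_assoc)
  then have "u \<bullet> ((M ** J) *v u) + \<alpha> * (u \<bullet> u) = 0"
    by (metis inner_add_right inner_scaleR_right inner_zero_right)
  then have "u \<bullet> u = 0"
    using assms(2) assms(3)[of u] inner_ge_zero[of u]
    by (smt (verit) mult_nonneg_nonneg mult_pos_pos)
  then show "x = 0"
    by (simp add: xu)
qed

text \<open>Invertible coefficients turn the two half-step equations into maps \<open>f\<close> and
  \<open>g\<close>, so the sequences are fixed by recursion on k. Existence keeps the convergence
  claim, which ranges over all solving sequences, from being vacuous.\<close>

lemma J_HSS_iteration_ex1:
  fixes A J :: "real^'n^'n"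
  assumes "J_HSS_well_defined A J \<alpha>"
  shows "\<exists>!(x, y). J_HSS_iteration A J b \<alpha> x0 x y"
proof -
  define B where "B = J_sym_part J A + \<alpha> *\<^sub>R matrix_inv J"
  define C where "C = J_skew_part J A + \<alpha> *\<^sub>R matrix_inv J"
  define f where "f x = matrix_inv B *v ((\<alpha> *\<^sub>R matrix_inv J - J_skew_part J A) *v x + b)" for x
  define g where "g y = matrix_inv C *v ((\<alpha> *\<^sub>R matrix_inv J - J_sym_part J A) *v y + b)" for y
  have solve: "M *v z = r \<longleftrightarrow> z = matrix_inv M *v r" if "invertible M"
    for M :: "real^'n^'n" and z r
    using matrix_inv_cancel[OF that] by (metis matrix_vector_mul_assoc matrix_vector_mul_lid)
  have "invertible B" "invertible C"
    using assms by (simp_all add: J_HSS_well_defined_def B_def C_def)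
  then have iter: "J_HSS_iteration A J b \<alpha> x0 x y \<longleftrightarrow>
      x 0 = x0 \<and> (\<forall>k. y k = f (x k) \<and> x (Suc k) = g (y k))" for x y
    unfolding J_HSS_iteration_def f_def g_def B_def[symmetric] C_def[symmetric] by (simp add: solve)
  \<comment> \<open>The full iterates follow the composite of \<open>f\<close> and \<open>g\<close>;
    the half iterates are then \<open>f (X k)\<close>.\<close>
  define X where "X = rec_nat x0 (\<lambda>_ x. g (f x))"
  have X: "X 0 = x0" "\<And>k. X (Suc k) = g (f (X k))"
    by (simp_all add: X_def)
  show ?thesis
  proof (rule ex1I[of _ "(X, \<lambda>k. f (X k))"])
    show "case (X, \<lambda>k. f (X k)) of (x, y) \<Rightarrow> J_HSS_iteration A J b \<alpha> x0 x y"
      by (simp add: iter X)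
  next
    fix p assume p: "case p of (x, y) \<Rightarrow> J_HSS_iteration A J b \<alpha> x0 x y"
    obtain x y where xy: "p = (x, y)" by (cases p)
    with p have it: "x 0 = x0" "\<And>k. y k = f (x k)" "\<And>k. x (Suc k) = g (y k)"
      by (auto simp: iter)
    have "x k = X k" for k
      by (induction k) (simp_all add: it X)
    then show "p = (X, \<lambda>k. f (X k))"
      by (auto simp: xy it)
  qed
qed

text \<open>The errors, multiplied by J^-1, obey the abstract splitting with P = H J and Q = S
  J.\<close>

lemma J_HSS_converges:
  fixes A J :: "real^'n^'n"
  assumes J: "invertible J" and "\<alpha> > 0"
    and P: "\<And>x. 0 \<le> x \<bullet> ((J_sym_part J A ** J) *v x)"
    and Q: "\<And>x. 0 \<le> x \<bullet> ((J_skew_part J A ** J) *v x)"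
    and strict: "(\<forall>x. x \<noteq> 0 \<longrightarrow> x \<bullet> ((J_sym_part J A ** J) *v x) > 0) \<or>
      (\<forall>x. x \<noteq> 0 \<longrightarrow> x \<bullet> ((J_skew_part J A ** J) *v x) > 0)"
    and xs: "A *v xs = b" and iter: "J_HSS_iteration A J b \<alpha> x0 x y"
  shows "x \<longlonglongrightarrow> xs"
proof -
  define H where "H = J_sym_part J A"
  define S where "S = J_skew_part J A"
  define K where "K = matrix_inv J"
  define u where "u k = K *v (x k - xs)" for k
  define v where "v k = K *v (y k - xs)" for k
  have JK: "J *v (K *v z) = z" for z
    by (simp add: K_def matrix_vector_mul_assoc matrix_inv_cancel[OF J])
  \<comment> \<open>Written this way, \<open>b\<close> makes the exact solution a fixed point of
    both half steps, so it drops out of the error equations.\<close>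
  have b: "b = H *v xs + S *v xs"
    using xs J_parts_add[of A J] by (metis H_def S_def matrix_vector_mult_add_rdistrib)
  have half: "H *v y k + \<alpha> *\<^sub>R (K *v y k) = \<alpha> *\<^sub>R (K *v x k) - S *v x k + b"
    and full: "S *v x (Suc k) + \<alpha> *\<^sub>R (K *v x (Suc k)) = \<alpha> *\<^sub>R (K *v y k) - H *v y k + b" for k
    using iter unfolding J_HSS_iteration_def H_def[symmetric] S_def[symmetric] K_def[symmetric]
    by (simp_all add: matrix_vector_mult_add_rdistrib matrix_vector_mult_diff_rdistrib
        scaleR_matrix_vector_assoc)
  have "u \<longlonglongrightarrow> 0"
  proof (rule splitting_errors_tendsto_0[where P = "H ** J" and Q = "S ** J" and v = v])
    show "(H ** J) *v v k + \<alpha> *\<^sub>R v k = \<alpha> *\<^sub>R u k - (S ** J) *v u k" for k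
      using half[of k] unfolding u_def v_def b matrix_vector_mul_assoc[symmetric] JK
      by (simp add: matrix_vector_mult_diff_distrib algebra_simps)
    show "(S ** J) *v u (Suc k) + \<alpha> *\<^sub>R u (Suc k) = \<alpha> *\<^sub>R v k - (H ** J) *v v k" for k
      using full[of k] unfolding u_def v_def b matrix_vector_mul_assoc[symmetric] JK
      by (simp add: matrix_vector_mult_diff_distrib algebra_simps)
  qed (use P Q strict \<open>\<alpha> > 0\<close> in \<open>simp_all add: H_def S_def\<close>)
  \<comment> \<open>Undoing the substitution: J u_k + xs is the iterate x_k itself.\<close>
  then have "(\<lambda>k. J *v u k + xs) \<longlonglongrightarrow> J *v 0 + xs"
    by (intro tendsto_intros bounded_linear.tendsto[OF matrix_vector_mul_bounded_linear])
  then show ?thesis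
    by (simp add: u_def JK)
qed

text \<open>The common core of both cases of the theorem, which differ only in which of the two
  forms is strictly positive.\<close>

lemma J_HSS_unconditionally_convergent:
  fixes A J :: "real^'n^'n"
  assumes A: "invertible A" and J: "invertible J"
    and P: "\<And>x. 0 \<le> x \<bullet> ((J_sym_part J A ** J) *v x)"
    and Q: "\<And>x. 0 \<le> x \<bullet> ((J_skew_part J A ** J) *v x)"
    and strict: "(\<forall>x. x \<noteq> 0 \<longrightarrow> x \<bullet> ((J_sym_part J A ** J) *v x) > 0) \<or>
      (\<forall>x. x \<noteq> 0 \<longrightarrow> x \<bullet> ((J_skew_part J A ** J) *v x) > 0)"
  shows "\<forall>\<alpha>>0. \<forall>x0. J_HSS_well_defined A J \<alpha> \<and>
    (\<exists>!(x, y). J_HSS_iteration A J b \<alpha> x0 x y) \<and>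
    (\<exists>xs. A *v xs = b \<and> (\<forall>z. A *v z = b \<longrightarrow> z = xs) \<and>
      (\<forall>x y. J_HSS_iteration A J b \<alpha> x0 x y \<longrightarrow> x \<longlonglongrightarrow> xs))"
proof (intro allI impI)
  fix \<alpha> :: real and x0
  assume \<alpha>: "\<alpha> > 0"
  have wd: "J_HSS_well_defined A J \<alpha>"
    unfolding J_HSS_well_defined_def
    using invertible_add_scaled_matrix_inv[OF J \<alpha> P] invertible_add_scaled_matrix_inv[OF J \<alpha> Q] ..
  have sol: "A *v (matrix_inv A *v b) = b"
    by (simp add: matrix_vector_mul_assoc matrix_inv_cancel[OF A])
  have "z = matrix_inv A *v b" if "A *v z = b" for z
    unfolding that[symmetric] by (simp add: matrix_vector_mul_assoc matrix_inv_cancel[OF A])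
  then show "J_HSS_well_defined A J \<alpha> \<and>
    (\<exists>!(x, y). J_HSS_iteration A J b \<alpha> x0 x y) \<and>
    (\<exists>xs. A *v xs = b \<and> (\<forall>z. A *v z = b \<longrightarrow> z = xs) \<and>
      (\<forall>x y. J_HSS_iteration A J b \<alpha> x0 x y \<longrightarrow> x \<longlonglongrightarrow> xs))"
    using wd J_HSS_iteration_ex1[OF wd] sol J_HSS_converges[OF J \<alpha> P Q strict sol] by blast
qed

section \<open>Parity of the dimension and the two cases of the theorem\<close>

lemma positive_definite_imp_nonneg:
  assumes "positive_definite M"
  shows "0 \<le> x \<bullet> (M *v x)"
  using assms by (cases "x = 0") (auto simp: positive_definite_def intro: less_imp_le)

text \<open>In odd dimension det J = det (- J^T) = - det J, so det J = 0, against
  invertibility.\<close>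

lemma even_dimension_if_skew_invertible:
  fixes J :: "real^'n^'n"
  assumes "invertible J" "J = - transpose J"
  shows "even CARD('n)"
proof (rule ccontr)
  assume "odd CARD('n)"
  \<comment> \<open>Negation is written as the matrix of scaling by -1, whose determinant is (-1)^n,
    so that multiplicativity of \<open>det\<close> applies.\<close>
  have "- transpose J = matrix ((*\<^sub>R) (- 1)) ** transpose J"
    by (simp add: matrix_eq matrix_works linear_scaleR uminus_matrix_vector flip: matrix_vector_mul_assoc)
  then have "det J = det (matrix ((*\<^sub>R) (- 1)) :: real^'n^'n) * det (transpose J)"
    using assms(2) by (metis det_mul)
  also have "\<dots> = - det J"
    using \<open>odd CARD('n)\<close> by simp
  finally show False
    using assms(1) by (simp add: invertible_det_nz)
qed

theorem proposition5p1:
  fixes A J :: "real^'n^'n" and b :: "real^'n"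
  assumes "invertible A" and "invertible J"
    and "J = transpose J \<or> J = - transpose J"
  shows
    "(linear (J_involution J) \<and> (\<forall>X. J_involution J (J_involution J X) = X) \<and>
      J_skew_matrices J = eigenspace (J_involution J) 1 \<and>
      J_sym_matrices J = eigenspace (J_involution J) (-1) \<and>
      subspace (J_skew_matrices J) \<and> subspace (J_sym_matrices J) \<and>
      (\<forall>X. \<exists>!(Y, Z). Y \<in> J_skew_matrices J \<and> Z \<in> J_sym_matrices J \<and> X = Y + Z) \<and>
      J_sym_part J A \<in> J_sym_matrices J \<and> J_skew_part J A \<in> J_skew_matrices J \<and>
      A = J_sym_part J A + J_skew_part J A)
     \<and>
     (J = transpose J \<longrightarrow>
       symmetric_matrix (J_sym_part J A ** J) \<and>
       (positive_definite (J_sym_part J A ** J) \<longrightarrow>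
         (\<forall>\<alpha>>0. \<forall>x0.
            J_HSS_well_defined A J \<alpha> \<and>
            (\<exists>!(x, y). J_HSS_iteration A J b \<alpha> x0 x y) \<and>
            (\<exists>xs. A *v xs = b \<and> (\<forall>z. A *v z = b \<longrightarrow> z = xs) \<and>
               (\<forall>x y. J_HSS_iteration A J b \<alpha> x0 x y \<longrightarrow> x \<longlonglongrightarrow> xs)))))
     \<and>
     (J = - transpose J \<longrightarrow>
       symmetric_matrix (J_skew_part J A ** J) \<and>
       (positive_definite (J_skew_part J A ** J) \<longrightarrow>
         (\<forall>\<alpha>>0. \<forall>x0.
            J_HSS_well_defined A J \<alpha> \<and>
            (\<exists>!(x, y). J_HSS_iteration A J b \<alpha> x0 x y) \<and>
            (\<exists>xs. A *v xs = b \<and> (\<forall>z. A *v z = b \<longrightarrow> z = xs) \<and>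
               (\<forall>x y. J_HSS_iteration A J b \<alpha> x0 x y \<longrightarrow> x \<longlonglongrightarrow> xs))) \<and>
         even CARD('n)))"
proof (rule conjI, rule_tac[2] conjI)
  let ?H = "J_sym_part J A" and ?S = "J_skew_part J A"
  \<comment> \<open>\<open>s\<close> is 1 for symmetric J and -1 otherwise, so the decomposition is
    established once for both cases.\<close>
  obtain s where s: "transpose J = s *\<^sub>R J" "s * s = 1"
  proof (cases "J = transpose J")
    case True
    then show thesis using that[of 1] by simp
  next
    case False
    then have "J = - transpose J" using assms(3) by blast
    then have "transpose J = (- 1) *\<^sub>R J" by (metis minus_minus scaleR_minus1_left)
    then show thesis using that[of "- 1"] by simp
  qed
  show "linear (J_involution J) \<and> (\<forall>X. J_involution J (J_involution J X) = X) \<and>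
      J_skew_matrices J = eigenspace (J_involution J) 1 \<and>
      J_sym_matrices J = eigenspace (J_involution J) (-1) \<and>
      subspace (J_skew_matrices J) \<and> subspace (J_sym_matrices J) \<and>
      (\<forall>X. \<exists>!(Y, Z). Y \<in> J_skew_matrices J \<and> Z \<in> J_sym_matrices J \<and> X = Y + Z) \<and>
      ?H \<in> J_sym_matrices J \<and> ?S \<in> J_skew_matrices J \<and> A = ?H + ?S"
    by (intro conjI allI linear_J_involution J_involution_involutive[OF assms(2) s]
        J_skew_matrices_eq_eigenspace J_sym_matrices_eq_eigenspace
        J_decomposition_unique[OF assms(2) s] J_parts_mem[OF assms(2) s] J_parts_add)
      (simp_all add: J_skew_matrices_eq_eigenspace J_sym_matrices_eq_eigenspace
        subspace_eigenspace[OF linear_J_involution])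
  note mem = J_parts_mem[OF assms(2) s, of A]
  let ?C = "\<forall>\<alpha>>0. \<forall>x0. J_HSS_well_defined A J \<alpha> \<and>
    (\<exists>!(x, y). J_HSS_iteration A J b \<alpha> x0 x y) \<and>
    (\<exists>xs. A *v xs = b \<and> (\<forall>z. A *v z = b \<longrightarrow> z = xs) \<and>
      (\<forall>x y. J_HSS_iteration A J b \<alpha> x0 x y \<longrightarrow> x \<longlonglongrightarrow> xs))"
  show "J = transpose J \<longrightarrow> symmetric_matrix (?H ** J) \<and> (positive_definite (?H ** J) \<longrightarrow> ?C)"
  proof (intro impI conjI[of "symmetric_matrix _"])
    assume "J = transpose J"
    then have J1: "transpose J = 1 *\<^sub>R J" by simp
    show "symmetric_matrix (?H ** J)"
      using transpose_J_sym_mult[OF assms(2) J1 mem(1)] by (simp add: symmetric_matrix_def)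
    \<comment> \<open>For symmetric J the matrix S J is skew, so its form vanishes identically and
      is in particular nonnegative; strictness comes from H J.\<close>
    have "transpose (?S ** J) = - (?S ** J)"
      using transpose_J_skew_mult[OF assms(2) J1 mem(2)] by simp
    then have S: "0 \<le> x \<bullet> ((?S ** J) *v x)" for x
      by (simp add: skew_quadratic_form_zero)
    show ?C if pd: "positive_definite (?H ** J)"
      by (rule J_HSS_unconditionally_convergent[OF assms(1,2) positive_definite_imp_nonneg[OF pd] S])
        (use pd in \<open>simp add: positive_definite_def\<close>)
  qed
  show "J = - transpose J \<longrightarrow> symmetric_matrix (?S ** J) \<and>
    (positive_definite (?S ** J) \<longrightarrow> ?C \<and> even CARD('n))"
  proof (intro impI conjI[of "symmetric_matrix _"] conjI[of ?C])
    assume skew: "J = - transpose J"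
    then have J1: "transpose J = (- 1) *\<^sub>R J" by (metis minus_minus scaleR_minus1_left)
    show "symmetric_matrix (?S ** J)"
      using transpose_J_skew_mult[OF assms(2) J1 mem(2)] by (simp add: symmetric_matrix_def)
    \<comment> \<open>For skew J the roles are exchanged: the form of H J vanishes and S J supplies
      strictness.\<close>
    have "transpose (?H ** J) = - (?H ** J)"
      using transpose_J_sym_mult[OF assms(2) J1 mem(1)] by simp
    then have H: "0 \<le> x \<bullet> ((?H ** J) *v x)" for x
      by (simp add: skew_quadratic_form_zero)
    show ?C if pd: "positive_definite (?S ** J)"
      by (rule J_HSS_unconditionally_convergent[OF assms(1,2) H positive_definite_imp_nonneg[OF pd]])
        (use pd in \<open>simp add: positive_definite_def\<close>)
    show "even CARD('n)"
      by (rule even_dimension_if_skew_invertible[OF assms(2) skew])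
  qed
qed

end
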